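(* Let $n\ge 1$, let $f:\{0,1\}^n\to\{0,1\}$ be either constant or balanced, and let $f_0,f_1:\{0,1\}^{n-1}\to\{0,1\}$ be given by $f_0(u)=f(u0)$, $f_1(u)=f(u1)$. Consider the following procedure on $n$ qubits (a register of $n-1$ qubits followed by one further qubit), which uses one query to each of the oracles $O_{f_0}$, $O_{f_1}$: 1. Prepare $|0^{n-1}\rangle|0\rangle$ and apply $H^{\otimes (n-1)}\otimes I$. 2. Apply $O_{f_0}$, then $I\otimes Z$ (with $Z$ acting on the last qubit), then $O_{f_1}$. 3. Measure the last qubit in the computational basis. If the result is $1$, output "balanced" and stop. 4. If the result is $0$, apply $H^{\otimes (n-1)}\otimes I$ to the post-measurement state and measure the first $n-1$ qubits in the computational basis. If the result is $0^{n-1}$, output "constant"; otherwise output "balanced". Then the procedure is exact: with probability $1$ it outputs "constant" if $f$ is constant, and with probability $1$ it outputs "balanced" if $f$ is balanced.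
   Context: A Boolean function $f:\{0,1\}^n\to\{0,1\}$ is constant if $f\equiv 0$ or $f\equiv 1$, and balanced if $|\{x: f(x)=0\}|=|\{x: f(x)=1\}|=2^{n-1}$. For bit strings $u,w$, $uw$ denotes concatenation. For $i\in\{0,1\}$ the oracle $O_{f_i}$ is the unitary on $n$ qubits with $O_{f_i}|u\rangle|b\rangle=|u\rangle|b\oplus f_i(u)\rangle$ for $u\in\{0,1\}^{n-1}$, $b\in\{0,1\}$. $H$ is the one-qubit Hadamard gate, $H|b\rangle=\frac{1}{\sqrt2}(|0\rangle+(-1)^b|1\rangle)$, and $Z$ is the Pauli gate $Z|b\rangle=(-1)^b|b\rangle$. *)

theory Defs
  imports "HOL-Probability.Probability" "Jordan_Normal_Form.Matrix"
begin

section \<open>Boolean functions\<close>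

text \<open>Bit strings are lists of booleans. A function on \<open>{0,1}^n\<close> is a function on all lists of
  which only the values on \<^term>\<open>bit_strings n\<close> are ever used.\<close>

definition bit_strings :: "nat \<Rightarrow> bool list set" where
  "bit_strings n = {x. length x = n}"

definition constant_fun :: "nat \<Rightarrow> (bool list \<Rightarrow> bool) \<Rightarrow> bool" where
  "constant_fun n f \<longleftrightarrow>
     (\<forall>x\<in>bit_strings n. f x = False) \<or> (\<forall>x\<in>bit_strings n. f x = True)"

definition balanced_fun :: "nat \<Rightarrow> (bool list \<Rightarrow> bool) \<Rightarrow> bool" where
  "balanced_fun n f \<longleftrightarrow>
     card {x \<in> bit_strings n. f x = False} = 2 ^ (n - 1) \<and>
     card {x \<in> bit_strings n. f x = True} = 2 ^ (n - 1)"

definition restrict_last :: "(bool list \<Rightarrow> bool) \<Rightarrow> bool \<Rightarrow> (bool list \<Rightarrow> bool)" where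
  "restrict_last f b = (\<lambda>u. f (u @ [b]))"

section \<open>States and gates\<close>

text \<open>An \<open>n\<close>-qubit state is a complex vector of dimension \<open>2^n\<close>. The basis vector of the
  bit string \<open>x\<close> sits at the index with binary expansion \<open>x\<close>, leftmost bit most significant, so
  that concatenation of strings agrees with the Kronecker product below.\<close>

definition bits_index :: "bool list \<Rightarrow> nat" where
  "bits_index x = horner_sum of_bool 2 (rev x)"

definition ket :: "bool list \<Rightarrow> complex vec" where
  "ket x = unit_vec (2 ^ length x) (bits_index x)"

definition kron :: "complex mat \<Rightarrow> complex mat \<Rightarrow> complex mat" (infixr "\<otimes>\<^sub>K" 72) where
  "A \<otimes>\<^sub>K B = mat (dim_row A * dim_row B) (dim_col A * dim_col B)
     (\<lambda>(i, j). A $$ (i div dim_row B, j div dim_col B) * B $$ (i mod dim_row B, j mod dim_col B))"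

primrec kron_power :: "complex mat \<Rightarrow> nat \<Rightarrow> complex mat" where
  "kron_power A 0 = 1\<^sub>m 1"
| "kron_power A (Suc k) = A \<otimes>\<^sub>K kron_power A k"

definition hadamard :: "complex mat" where
  "hadamard = mat 2 2 (\<lambda>(i, j). (- 1) ^ (i * j) / complex_of_real (sqrt 2))"

definition pauli_Z :: "complex mat" where
  "pauli_Z = mat 2 2 (\<lambda>(i, j). if i = j then (- 1) ^ j else 0)"

text \<open>The gate \<open>O_g: |u\<rangle>|b\<rangle> \<mapsto> |u\<rangle>|b \<oplus> g(u)\<rangle>\<close> on \<open>m + 1\<close> qubits; on booleans, \<open>\<noteq>\<close> is addition modulo 2.\<close>

definition query_gate :: "nat \<Rightarrow> (bool list \<Rightarrow> bool) \<Rightarrow> complex mat" where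
  "query_gate m g = mat (2 ^ (m + 1)) (2 ^ (m + 1))
     (\<lambda>(i, j). if \<exists>u\<in>bit_strings m. \<exists>b.
                    j = bits_index (u @ [b]) \<and> i = bits_index (u @ [b \<noteq> g u]) then 1 else 0)"

section \<open>Measurement\<close>

definition vec_l2_norm :: "complex vec \<Rightarrow> real" where
  "vec_l2_norm v = L2_set (\<lambda>i. cmod (v $ i)) {..<dim_vec v}"

definition ket_projector :: "bool list \<Rightarrow> complex mat" where
  "ket_projector x = mat (2 ^ length x) (2 ^ length x) (\<lambda>(i, j). ket x $ i * cnj (ket x $ j))"

text \<open>Born rule for the projectors \<open>P r\<close>, \<open>r \<in> R\<close>: the joint distribution of the result and the
  normalized post-measurement state. The argument of \<^const>\<open>embed_pmf\<close> sums to 1 when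
  the \<open>P r\<close> are a complete family of orthogonal projectors and \<open>\<psi>\<close> is a unit vector;
  otherwise the value is unspecified.\<close>

definition projective_measurement ::
  "'r set \<Rightarrow> ('r \<Rightarrow> complex mat) \<Rightarrow> complex vec \<Rightarrow> ('r \<times> complex vec) pmf" where
  "projective_measurement R P \<psi> =
     map_pmf (\<lambda>r. (r, complex_of_real (1 / vec_l2_norm (P r *\<^sub>v \<psi>)) \<cdot>\<^sub>v (P r *\<^sub>v \<psi>)))
       (embed_pmf (\<lambda>r. if r \<in> R then (vec_l2_norm (P r *\<^sub>v \<psi>))\<^sup>2 else 0))"

text \<open>Computational-basis measurements on \<open>m + 1\<close> qubits.\<close>

definition measure_last_qubit :: "nat \<Rightarrow> complex vec \<Rightarrow> (bool \<times> complex vec) pmf" where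
  "measure_last_qubit m = projective_measurement UNIV (\<lambda>b. 1\<^sub>m (2 ^ m) \<otimes>\<^sub>K ket_projector [b])"

definition measure_first_qubits :: "nat \<Rightarrow> complex vec \<Rightarrow> (bool list \<times> complex vec) pmf" where
  "measure_first_qubits m =
     projective_measurement (bit_strings m) (\<lambda>x. ket_projector x \<otimes>\<^sub>K 1\<^sub>m 2)"

section \<open>The procedure\<close>

datatype verdict = Constant | Balanced

definition state_before_measurement :: "nat \<Rightarrow> (bool list \<Rightarrow> bool) \<Rightarrow> complex vec" where
  "state_before_measurement n f =
     query_gate (n - 1) (restrict_last f True) *\<^sub>v
     ((1\<^sub>m (2 ^ (n - 1)) \<otimes>\<^sub>K pauli_Z) *\<^sub>v
     (query_gate (n - 1) (restrict_last f False) *\<^sub>v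
     ((kron_power hadamard (n - 1) \<otimes>\<^sub>K 1\<^sub>m 2) *\<^sub>v
     ket (replicate (n - 1) False @ [False]))))"

definition procedure_output :: "nat \<Rightarrow> (bool list \<Rightarrow> bool) \<Rightarrow> verdict pmf" where
  "procedure_output n f =
     do {
       (b, \<psi>) \<leftarrow> measure_last_qubit (n - 1) (state_before_measurement n f);
       if b then return_pmf Balanced
       else do {
         (x, _) \<leftarrow> measure_first_qubits (n - 1)
                    ((kron_power hadamard (n - 1) \<otimes>\<^sub>K 1\<^sub>m 2) *\<^sub>v \<psi>);
         return_pmf (if x = replicate (n - 1) False then Constant else Balanced)
       }
     }"

section \<open>Action of the gates on basis states\<close>

lemma bits_index_append: "bits_index (x @ y) = bits_index x * 2 ^ length y + bits_index y"
  by (simp add: bits_index_def horner_sum_append)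

lemma bits_index_less: "bits_index x < 2 ^ length x"
  using horner_sum_of_bool_2_less[of "rev x"] by (simp add: bits_index_def flip: of_nat_less_iff)

lemma bits_index_inj: "length x = length y \<Longrightarrow> bits_index x = bits_index y \<longleftrightarrow> x = y"
proof
  assume len: "length x = length y" and eq: "bits_index x = bits_index y"
  have "rev x = rev y"
  proof (rule nth_equalityI)
    show "rev x ! i = rev y ! i" if "i < length (rev x)" for i
      using arg_cong[OF eq, of "\<lambda>k. bit k i"] that len
      by (simp add: bits_index_def bit_horner_sum_bit_iff)
  qed (use len in simp)
  then show "x = y" by simp
qed simp

lemma mult_mat_unit_vec:
  assumes "A \<in> carrier_mat r c" "j < c"
  shows "(A :: complex mat) *\<^sub>v unit_vec c j = vec r (\<lambda>i. A $$ (i, j))"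
  using assms by (intro eq_vecI) auto

lemma hadamard_ket:
  "hadamard *\<^sub>v ket [b] =
     complex_of_real (1 / sqrt 2) \<cdot>\<^sub>v (ket [False] + (- 1) ^ of_bool b \<cdot>\<^sub>v ket [True])"
  by (intro eq_vecI; cases b)
    (auto simp: hadamard_def ket_def bits_index_def scalar_prod_def less_Suc_eq numeral_2_eq_2)

lemma pauli_Z_ket: "pauli_Z *\<^sub>v ket [b] = (- 1) ^ of_bool b \<cdot>\<^sub>v ket [b]"
  by (intro eq_vecI; cases b)
    (auto simp: pauli_Z_def ket_def bits_index_def scalar_prod_def less_Suc_eq numeral_2_eq_2)

lemma query_gate_ket:
  assumes "length u = m"
  shows "query_gate m g *\<^sub>v ket (u @ [b]) = ket (u @ [b \<noteq> g u])"
proof -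
  have "bits_index (u @ [c]) < 2 ^ (m + 1)" for c
    using bits_index_less[of "u @ [c]"] assms by simp
  moreover have "(\<exists>v\<in>bit_strings m. \<exists>c. bits_index (u @ [b]) = bits_index (v @ [c])
      \<and> i = bits_index (v @ [c \<noteq> g v])) \<longleftrightarrow> i = bits_index (u @ [b \<noteq> g u])" (is "?L \<longleftrightarrow> ?R") for i
  proof
    assume ?L
    then obtain v c where v: "length v = m" "bits_index (u @ [b]) = bits_index (v @ [c])"
      "i = bits_index (v @ [c \<noteq> g v])"
      unfolding bit_strings_def by blast
    then have "u @ [b] = v @ [c]"
      using bits_index_inj[of "u @ [b]" "v @ [c]"] assms by simp
    then show ?R using v(3) by simp
  next
    assume ?R
    then show ?L using assms unfolding bit_strings_def by blast
  qed
  ultimately show ?thesis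
    using assms unfolding ket_def
    by (subst mult_mat_unit_vec[of _ "2 ^ (m + 1)"])
      (auto simp: query_gate_def unit_vec_def intro!: eq_vecI)
qed

end

(* The queries prepare 2^(-m/2) times the sum over u of (-1)^(f(u0)) |u>|f(u0) + f(u1)>, where
   m = n - 1. Result 0 of the last measurement keeps exactly the u with f(u0) = f(u1), and after the
   second Hadamard layer the amplitude of 0^m is proportional to the sum of (-1)^(f(u0)) over these u.
   The terms with f(u0) /= f(u1) cancel in the sum of (-1)^(f(x)) over all x, so that this
   amplitude vanishes when f is balanced. When f is constant, result 1 cannot occur and the amplitude
   has modulus 1, which leaves no weight for the other basis states. *)

theory Submission
  imports Defs
begin

section \<open>Bit strings and their indices\<close>

text \<open>Matrix entries are addressed by numbers while \<open>f\<close> takes strings; this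
  inverse translates back. At numbers from \<open>2 ^ m\<close> on its value is unspecified, hence
  the bounds on \<open>i\<close> below.\<close>

definition index_bits :: "nat \<Rightarrow> nat \<Rightarrow> bool list" where
  "index_bits m = inv_into (bit_strings m) bits_index"

lemma finite_bit_strings: "finite (bit_strings m)"
  using finite_lists_length_eq[of "UNIV :: bool set" m] by (simp add: bit_strings_def)

lemma card_bit_strings: "card (bit_strings m) = 2 ^ m"
  using card_lists_length_eq[of "UNIV :: bool set" m] by (simp add: bit_strings_def)

text \<open>Injectivity and counting suffice: \<open>2 ^ m\<close> strings receive distinct indices
  among \<open>2 ^ m\<close> numbers, so no binary expansion has to be constructed.\<close>

lemma bij_betw_bits_index: "bij_betw bits_index (bit_strings m) {..<2 ^ m}"
proof -
  have inj: "inj_on bits_index (bit_strings m)"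
    by (auto simp: inj_on_def bit_strings_def bits_index_inj)
  have "bits_index ` bit_strings m \<subseteq> {..<2 ^ m}"
    using bits_index_less by (auto simp: bit_strings_def)
  moreover have "card (bits_index ` bit_strings m) = card {..<2 ^ m :: nat}"
    using inj by (simp add: card_image card_bit_strings)
  ultimately have "bits_index ` bit_strings m = {..<2 ^ m}"
    by (intro card_subset_eq) auto
  with inj show ?thesis by (simp add: bij_betw_def)
qed

lemma index_bits_bits_index: "length u = m \<Longrightarrow> index_bits m (bits_index u) = u"
  unfolding index_bits_def
  using bij_betw_inv_into_left[OF bij_betw_bits_index, of u m] by (simp add: bit_strings_def)

lemma bits_index_index_bits: "i < 2 ^ m \<Longrightarrow> bits_index (index_bits m i) = i"
  unfolding index_bits_def
  using bij_betw_inv_into_right[OF bij_betw_bits_index, of i m] by simp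

lemma index_bits_in: "i < 2 ^ m \<Longrightarrow> index_bits m i \<in> bit_strings m"
  unfolding index_bits_def
  using bij_betw_apply[OF bij_betw_inv_into[OF bij_betw_bits_index], of i m] by simp

lemma sum_bit_strings_index:
  "(\<Sum>u\<in>bit_strings m. h u) = (\<Sum>i<2 ^ m. h (index_bits m i))"
  unfolding index_bits_def
  using sum.reindex_bij_betw[OF bij_betw_inv_into[OF bij_betw_bits_index], of h m] by simp

lemma bits_index_snoc: "bits_index (u @ [b]) = 2 * bits_index u + of_bool b"
  by (simp add: bits_index_append) (simp add: bits_index_def)

lemma bits_index_singleton: "bits_index [b] = of_bool b"
  by (simp add: bits_index_def)

lemma bits_index_zeros: "bits_index (replicate m False) = 0"
proof (induction m)
  case (Suc m)
  then show ?case
    using bits_index_append[of "[False]" "replicate m False"] by (simp add: bits_index_singleton)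
qed (simp add: bits_index_def)

lemma bits_index_eq_0_iff: "length u = m \<Longrightarrow> bits_index u = 0 \<longleftrightarrow> u = replicate m False"
  using bits_index_inj[of u "replicate m False"] by (simp add: bits_index_zeros)

text \<open>Every nonempty string is uniquely a prefix followed by a last bit. This relates sums
  over the domain of \<open>f\<close> to sums over the common domain of its two
  restrictions.\<close>

lemma sum_bit_strings_Suc:
  "(\<Sum>x\<in>bit_strings (Suc m). h x) =
     (\<Sum>u\<in>bit_strings m. h (u @ [False]) + h (u @ [True]))"
  for h :: "bool list \<Rightarrow> 'a :: comm_monoid_add"
proof -
  have "bij_betw (\<lambda>(u, b). u @ [b]) (bit_strings m \<times> UNIV) (bit_strings (Suc m))"
    unfolding bij_betw_def
  proof
    show "(\<lambda>(u, b). u @ [b]) ` (bit_strings m \<times> UNIV) = bit_strings (Suc m)"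
    proof (intro equalityI subsetI)
      fix x assume x: "x \<in> bit_strings (Suc m)"
      then obtain u b where "x = u @ [b]"
        by (cases x rule: rev_cases) (auto simp: bit_strings_def)
      with x show "x \<in> (\<lambda>(u, b). u @ [b]) ` (bit_strings m \<times> UNIV)"
        by (intro image_eqI[of _ _ "(u, b)"]) (auto simp: bit_strings_def)
    qed (auto simp: bit_strings_def)
  qed (auto simp: inj_on_def)
  from sum.reindex_bij_betw[OF this, of h]
  have "(\<Sum>x\<in>bit_strings (Suc m). h x) = (\<Sum>(u, b)\<in>bit_strings m \<times> UNIV. h (u @ [b]))"
    by (simp add: case_prod_beta')
  also have "\<dots> = (\<Sum>u\<in>bit_strings m. h (u @ [False]) + h (u @ [True]))"
    by (simp add: sum.cartesian_product[symmetric] UNIV_bool)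
  finally show ?thesis .
qed

lemma sum_double: "(\<Sum>k<2 * N. h k) = (\<Sum>i<N. h (2 * i) + h (2 * i + 1))"
  for h :: "nat \<Rightarrow> 'a :: comm_monoid_add"
  by (induction N) (simp_all add: ac_simps)

section \<open>States with a distinguished last qubit\<close>

text \<open>The last qubit is the least significant bit of the index, so parity reads it off and
  halving leaves the index of the first register. In this form gates and projectors become formulas
  on amplitude functions.\<close>

definition amp_vec :: "nat \<Rightarrow> (nat \<Rightarrow> bool \<Rightarrow> complex) \<Rightarrow> complex vec" where
  "amp_vec N a = vec (2 * N) (\<lambda>k. a (k div 2) (odd k))"

lemma amp_vec_cong:
  "(\<And>i c. i < N \<Longrightarrow> a i c = a' i c) \<Longrightarrow> amp_vec N a = amp_vec N a'"
  unfolding amp_vec_def by (intro eq_vecI) auto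

lemma smult_amp_vec: "r \<cdot>\<^sub>v amp_vec N a = amp_vec N (\<lambda>i c. r * a i c)"
  unfolding amp_vec_def by (intro eq_vecI) auto

lemma vec_l2_norm_amp_vec:
  "(vec_l2_norm (amp_vec N a))\<^sup>2 = (\<Sum>i<N. (cmod (a i False))\<^sup>2 + (cmod (a i True))\<^sup>2)"
proof -
  have "(vec_l2_norm (amp_vec N a))\<^sup>2 = (\<Sum>k<2 * N. (cmod (a (k div 2) (odd k)))\<^sup>2)"
    unfolding vec_l2_norm_def L2_set_def
    by (subst real_sqrt_pow2) (auto simp: amp_vec_def intro!: sum_nonneg sum.cong)
  then show ?thesis by (simp add: sum_double)
qed

lemma vec_l2_norm_smult: "vec_l2_norm (r \<cdot>\<^sub>v v) = cmod r * vec_l2_norm v"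
proof -
  have "vec_l2_norm (r \<cdot>\<^sub>v v) = L2_set (\<lambda>i. cmod r * cmod (v $ i)) {..<dim_vec v}"
    unfolding vec_l2_norm_def by (intro L2_set_cong) (auto simp: norm_mult)
  then show ?thesis by (simp add: vec_l2_norm_def L2_set_right_distrib)
qed

text \<open>Grouping the columns in pairs, even before odd, separates the two values of the last
  qubit. The actions of Kronecker products and of the query gate are all derived from this
  formula.\<close>

lemma mult_mat_amp_vec:
  assumes "A \<in> carrier_mat (2 * N) (2 * M)"
  shows "A *\<^sub>v amp_vec M a = amp_vec N (\<lambda>i c.
    \<Sum>j<M. A $$ (2 * i + of_bool c, 2 * j) * a j False
          + A $$ (2 * i + of_bool c, 2 * j + 1) * a j True)"
proof (rule eq_vecI)
  fix k assume k: "k < dim_vec (amp_vec N (\<lambda>i c.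
    \<Sum>j<M. A $$ (2 * i + of_bool c, 2 * j) * a j False
          + A $$ (2 * i + of_bool c, 2 * j + 1) * a j True))"
  then have k': "k < 2 * N" by (simp add: amp_vec_def)
  have "(A *\<^sub>v amp_vec M a) $ k = (\<Sum>l<2 * M. A $$ (k, l) * a (l div 2) (odd l))"
    using assms k' by (auto simp: scalar_prod_def amp_vec_def atLeast0LessThan intro!: sum.cong)
  also have "2 * (k div 2) + of_bool (odd k) = k"
    by (simp add: mod_2_eq_odd[symmetric])
  ultimately show "(A *\<^sub>v amp_vec M a) $ k = amp_vec N (\<lambda>i c.
    \<Sum>j<M. A $$ (2 * i + of_bool c, 2 * j) * a j False
          + A $$ (2 * i + of_bool c, 2 * j + 1) * a j True) $ k"
    using k' by (simp add: sum_double amp_vec_def)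
qed (use assms in \<open>simp add: amp_vec_def\<close>)

section \<open>Gates acting on one tensor factor and oracle queries\<close>

lemma kron_carrier:
  "A \<in> carrier_mat r c \<Longrightarrow> B \<in> carrier_mat r' c' \<Longrightarrow> A \<otimes>\<^sub>K B \<in> carrier_mat (r * r') (c * c')"
  by (auto simp: kron_def)

lemma index_kron:
  "A \<in> carrier_mat r c \<Longrightarrow> B \<in> carrier_mat r' c' \<Longrightarrow> i < r * r' \<Longrightarrow> j < c * c' \<Longrightarrow>
   (A \<otimes>\<^sub>K B) $$ (i, j) = A $$ (i div r', j div c') * B $$ (i mod r', j mod c')"
  by (auto simp: kron_def)

lemma kron_one_amp_vec:
  assumes "A \<in> carrier_mat N M"
  shows "(A \<otimes>\<^sub>K 1\<^sub>m 2) *\<^sub>v amp_vec M a = amp_vec N (\<lambda>i c. \<Sum>j<M. A $$ (i, j) * a j c)"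
proof -
  have "A \<otimes>\<^sub>K 1\<^sub>m 2 \<in> carrier_mat (2 * N) (2 * M)"
    using kron_carrier[OF assms, of "1\<^sub>m 2" 2 2] by (simp add: mult.commute)
  from mult_mat_amp_vec[OF this] show ?thesis
    using assms
    by (auto intro!: amp_vec_cong sum.cong simp: index_kron[OF assms, of "1\<^sub>m 2" 2 2])
qed

lemma one_kron_amp_vec:
  assumes "B \<in> carrier_mat 2 2"
  shows "(1\<^sub>m N \<otimes>\<^sub>K B) *\<^sub>v amp_vec N a = amp_vec N (\<lambda>i c.
    B $$ (of_bool c, 0) * a i False + B $$ (of_bool c, 1) * a i True)"
proof -
  have "1\<^sub>m N \<otimes>\<^sub>K B \<in> carrier_mat (2 * N) (2 * N)"
    using kron_carrier[of "1\<^sub>m N" N N, OF _ assms] by (simp add: mult.commute)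
  from mult_mat_amp_vec[OF this] show ?thesis
  proof (simp, intro amp_vec_cong)
    fix i c assume "i < N"
    \<comment> \<open>The identity factor kills every block of columns except the one with
      \<open>j = i\<close>.\<close>
    have "(\<Sum>j<N. (1\<^sub>m N \<otimes>\<^sub>K B) $$ (2 * i + of_bool c, 2 * j) * a j False +
        (1\<^sub>m N \<otimes>\<^sub>K B) $$ (2 * i + of_bool c, Suc (2 * j)) * a j True)
      = (\<Sum>j<N. if i = j then B $$ (of_bool c, 0) * a j False + B $$ (of_bool c, 1) * a j True else 0)"
      using \<open>i < N\<close>
      by (intro sum.cong) (auto simp: index_kron[of "1\<^sub>m N" N N, OF _ assms])
    then show "(\<Sum>j<N. (1\<^sub>m N \<otimes>\<^sub>K B) $$ (2 * i + of_bool c, 2 * j) * a j False +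
        (1\<^sub>m N \<otimes>\<^sub>K B) $$ (2 * i + of_bool c, Suc (2 * j)) * a j True)
      = B $$ (of_bool c, 0) * a i False + B $$ (of_bool c, Suc 0) * a i True"
      using \<open>i < N\<close> by simp
  qed
qed

lemma ket_amp_vec:
  "length u = m \<Longrightarrow>
   ket (u @ [b]) = amp_vec (2 ^ m) (\<lambda>i c. of_bool (i = bits_index u \<and> c = b))"
  unfolding ket_def amp_vec_def
proof (intro eq_vecI)
  fix k :: nat
  assume "length u = m" "k < dim_vec (vec (2 * 2 ^ m)
    (\<lambda>k. of_bool (k div 2 = bits_index u \<and> odd k = b) :: complex))"
  moreover have "k = bits_index (u @ [b]) \<longleftrightarrow> k div 2 = bits_index u \<and> odd k = b"
    unfolding bits_index_snoc by (cases b) (auto elim: oddE)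
  ultimately show "unit_vec (2 ^ length (u @ [b])) (bits_index (u @ [b])) $ k = vec (2 * 2 ^ m)
    (\<lambda>k. of_bool (k div 2 = bits_index u \<and> odd k = b) :: complex) $ k"
    by (simp add: unit_vec_def)
qed auto

text \<open>The gate permutes basis states, and adding the oracle value to the last bit is its own
  inverse. Hence the amplitude arriving at \<open>(i, c)\<close> is the one that stood at the
  flipped bit.\<close>

lemma query_gate_amp_vec:
  "query_gate m g *\<^sub>v amp_vec (2 ^ m) a = amp_vec (2 ^ m) (\<lambda>i c. a i (c \<noteq> g (index_bits m i)))"
proof -
  define Q where "Q = query_gate m g"
  have Q: "Q \<in> carrier_mat (2 * 2 ^ m) (2 * 2 ^ m)" by (simp add: Q_def query_gate_def)
  have entry: "Q $$ (2 * i + of_bool c, 2 * j + of_bool d) =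
      of_bool (i = j \<and> d = (c \<noteq> g (index_bits m i)))"
    if ij: "i < 2 ^ m" "j < 2 ^ m" for i j c d
  proof -
    \<comment> \<open>Quotient and parity determine a number, so the condition in the gate splits
      into one on the prefix and one on the last bit.\<close>
    have eq: "2 * k + of_bool p = 2 * l + of_bool q \<longleftrightarrow> k = l \<and> p = q" for k l :: nat and p q
      by (cases p; cases q; simp; presburger)
    have "(\<exists>u\<in>bit_strings m. \<exists>b. 2 * j + of_bool d = bits_index (u @ [b]) \<and>
        2 * i + of_bool c = bits_index (u @ [b \<noteq> g u])) \<longleftrightarrow>
      (\<exists>u\<in>bit_strings m. j = bits_index u \<and> i = bits_index u \<and> c = (d \<noteq> g u))"
      unfolding bits_index_snoc eq by blast
    also have "\<dots> \<longleftrightarrow> i = j \<and> d = (c \<noteq> g (index_bits m i))"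
      using ij index_bits_in[of i m] bits_index_index_bits[of i m] index_bits_bits_index[of _ m]
      by (auto simp: bit_strings_def)
    finally have "(\<exists>u\<in>bit_strings m. \<exists>b. 2 * j + of_bool d = bits_index (u @ [b]) \<and>
        2 * i + of_bool c = bits_index (u @ [b \<noteq> g u])) \<longleftrightarrow> 
        i = j \<and> d = (c \<noteq> g (index_bits m i))" .
    moreover have "2 * i + of_bool c < (2 ^ (m + 1) :: nat)" "2 * j + of_bool d < (2 ^ (m + 1) :: nat)"
      using ij by (cases c; cases d; simp)+
    ultimately show ?thesis by (simp add: Q_def query_gate_def)
  qed
  have "(\<Sum>j<2 ^ m. Q $$ (2 * i + of_bool c, 2 * j) * a j False
      + Q $$ (2 * i + of_bool c, 2 * j + 1) * a j True) = a i (c \<noteq> g (index_bits m i))"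
    if i: "i < 2 ^ m" for i c
  proof -
    have "(\<Sum>j<2 ^ m. Q $$ (2 * i + of_bool c, 2 * j) * a j False
      + Q $$ (2 * i + of_bool c, 2 * j + 1) * a j True)
      = (\<Sum>j<2 ^ m. if i = j then a j (c \<noteq> g (index_bits m i)) else 0)"
    proof (intro sum.cong refl)
      fix j :: nat assume "j \<in> {..<2 ^ m}"
      then show "Q $$ (2 * i + of_bool c, 2 * j) * a j False
        + Q $$ (2 * i + of_bool c, 2 * j + 1) * a j True
        = (if i = j then a j (c \<noteq> g (index_bits m i)) else 0)"
        using entry[OF i, of j c False] entry[OF i, of j c True]
        by (cases "c \<noteq> g (index_bits m i)") auto
    qed
    then show ?thesis using i by simp
  qed
  with mult_mat_amp_vec[OF Q, of a] show ?thesis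
    by (auto simp: Q_def intro!: amp_vec_cong)
qed

section \<open>Hadamard powers\<close>

text \<open>The isometry condition \<open>A^* A = 1\<close> in entries, a form in which Kronecker
  products factor.\<close>

definition orthonormal_cols :: "complex mat \<Rightarrow> bool" where
  "orthonormal_cols A \<longleftrightarrow> (\<forall>j<dim_col A. \<forall>k<dim_col A.
     (\<Sum>i<dim_row A. A $$ (i, j) * cnj (A $$ (i, k))) = of_bool (j = k))"

lemma sum_div_mod:
  "(\<Sum>k<p * q. h (k div q) (k mod q)) = (\<Sum>i<p. \<Sum>j<q. h i j)"
  for h :: "nat \<Rightarrow> nat \<Rightarrow> 'a :: comm_monoid_add"
proof (cases "q = 0")
  case False
  have "(\<Sum>k<p * q. h (k div q) (k mod q)) = (\<Sum>i<p. \<Sum>k\<in>{i * q..<i * q + q}. h (k div q) (k mod q))"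
    by (rule sum.nat_group[symmetric])
  also have "\<dots> = (\<Sum>i<p. \<Sum>j<q. h i j)"
  proof (rule sum.cong)
    fix i
    show "(\<Sum>k\<in>{i * q..<i * q + q}. h (k div q) (k mod q)) = (\<Sum>j<q. h i j)"
      using sum.shift_bounds_nat_ivl[of "\<lambda>k. h (k div q) (k mod q)" 0 "i * q" q] False
      by (simp add: atLeast0LessThan add.commute)
  qed simp
  finally show ?thesis .
qed simp

text \<open>The inner product of two columns of a Kronecker product is the product of the inner
  products of the corresponding columns of the factors.\<close>

lemma orthonormal_cols_kron:
  assumes "orthonormal_cols A" "orthonormal_cols B"
  shows "orthonormal_cols (A \<otimes>\<^sub>K B)"
  unfolding orthonormal_cols_def
proof (intro allI impI)
  fix j k assume "j < dim_col (A \<otimes>\<^sub>K B)" "k < dim_col (A \<otimes>\<^sub>K B)"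
  then have jk: "j < dim_col A * dim_col B" "k < dim_col A * dim_col B"
    by (simp_all add: kron_def)
  let ?q = "dim_col B"
  \<comment> \<open>A column index below a product forces both factors to be positive, so remainders
    modulo \<open>?q\<close> are valid column indices.\<close>
  have q: "?q > 0" using jk(1) by (cases "?q = 0") auto
  have jk': "j div ?q < dim_col A" "k div ?q < dim_col A" "j mod ?q < ?q" "k mod ?q < ?q"
    using jk q by (simp_all add: less_mult_imp_div_less)
  have "(\<Sum>i<dim_row (A \<otimes>\<^sub>K B). (A \<otimes>\<^sub>K B) $$ (i, j) * cnj ((A \<otimes>\<^sub>K B) $$ (i, k)))
    = (\<Sum>i<dim_row A * dim_row B.
        (A $$ (i div dim_row B, j div ?q) * cnj (A $$ (i div dim_row B, k div ?q)))
        * (B $$ (i mod dim_row B, j mod ?q) * cnj (B $$ (i mod dim_row B, k mod ?q))))"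
    using jk by (intro sum.cong) (auto simp: kron_def)
  also have "\<dots> = (\<Sum>i<dim_row A. A $$ (i, j div ?q) * cnj (A $$ (i, k div ?q)))
      * (\<Sum>i<dim_row B. B $$ (i, j mod ?q) * cnj (B $$ (i, k mod ?q)))"
    by (subst sum_div_mod[of "\<lambda>x y. A $$ (x, j div ?q) * cnj (A $$ (x, k div ?q))
      * (B $$ (y, j mod ?q) * cnj (B $$ (y, k mod ?q)))"]) (simp add: sum_product)
  also have "\<dots> = of_bool (j div ?q = k div ?q) * of_bool (j mod ?q = k mod ?q)"
    using assms jk' by (simp add: orthonormal_cols_def)
  also have "\<dots> = of_bool (j = k)"
    by (simp, metis div_mult_mod_eq)
  finally show "(\<Sum>i<dim_row (A \<otimes>\<^sub>K B). (A \<otimes>\<^sub>K B) $$ (i, j) * cnj ((A \<otimes>\<^sub>K B) $$ (i, k))) =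
    of_bool (j = k)" .
qed

lemma orthonormal_cols_hadamard: "orthonormal_cols hadamard"
  unfolding orthonormal_cols_def
  by (auto simp: hadamard_def less_Suc_eq numeral_2_eq_2 simp flip: of_real_mult)

lemma orthonormal_cols_kron_power: "orthonormal_cols A \<Longrightarrow> orthonormal_cols (kron_power A k)"
  by (induction k) (auto simp: orthonormal_cols_kron, simp add: orthonormal_cols_def)

text \<open>Isometries preserve the norm: once each squared modulus is written as
  \<open>z * cnj z\<close>, orthonormality leaves only the diagonal of the double sum over
  columns.\<close>

lemma sum_cmod_orthonormal_cols:
  assumes "orthonormal_cols A" "A \<in> carrier_mat N M"
  shows "(\<Sum>i<N. (cmod (\<Sum>j<M. A $$ (i, j) * v j))\<^sup>2) = (\<Sum>j<M. (cmod (v j))\<^sup>2)"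
proof -
  have "complex_of_real (\<Sum>i<N. (cmod (\<Sum>j<M. A $$ (i, j) * v j))\<^sup>2) =
    (\<Sum>i<N. \<Sum>j<M. \<Sum>k<M. v j * cnj (v k) * (A $$ (i, j) * cnj (A $$ (i, k))))"
    by (simp add: complex_norm_square sum_product algebra_simps del: of_real_power)
  \<comment> \<open>Two exchanges move the row sum innermost, where it is an inner product of
    columns.\<close>
  also have "\<dots> = (\<Sum>j<M. \<Sum>k<M. v j * cnj (v k) * (\<Sum>i<N. A $$ (i, j) * cnj (A $$ (i, k))))"
    unfolding sum_distrib_left
    by (subst sum.swap, rule sum.cong[OF refl], rule sum.swap)
  also have "\<dots> = (\<Sum>j<M. \<Sum>k<M. if j = k then v j * cnj (v k) else 0)"
    using assms by (intro sum.cong refl) (auto simp: orthonormal_cols_def)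
  also have "\<dots> = complex_of_real (\<Sum>j<M. (cmod (v j))\<^sup>2)"
    by (simp add: complex_norm_square del: of_real_power)
  finally show ?thesis using of_real_eq_iff by blast
qed

text \<open>The isometry acts separately on the amplitudes with last bit 0 and on those with last
  bit 1. This keeps the state normalized under the second Hadamard layer.\<close>

lemma vec_l2_norm_orthonormal_cols:
  assumes "orthonormal_cols A" "A \<in> carrier_mat N M"
  shows "vec_l2_norm ((A \<otimes>\<^sub>K 1\<^sub>m 2) *\<^sub>v amp_vec M a) = vec_l2_norm (amp_vec M a)"
proof (rule power2_eq_imp_eq)
  show "(vec_l2_norm ((A \<otimes>\<^sub>K 1\<^sub>m 2) *\<^sub>v amp_vec M a))\<^sup>2 = (vec_l2_norm (amp_vec M a))\<^sup>2"
    by (simp add: kron_one_amp_vec[OF assms(2)] vec_l2_norm_amp_vec sum.distrib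
      sum_cmod_orthonormal_cols[OF assms])
qed (simp_all add: vec_l2_norm_def)

lemma kron_power_carrier:
  "A \<in> carrier_mat r c \<Longrightarrow> kron_power A k \<in> carrier_mat (r ^ k) (c ^ k)"
  by (induction k) (auto simp: kron_carrier)

lemma hadamard_carrier: "hadamard \<in> carrier_mat 2 2"
  by (simp add: hadamard_def)

lemmas hadamard_power_carrier = kron_power_carrier[OF hadamard_carrier]

text \<open>Row 0 gives the amplitude of the all-zero string after the second Hadamard layer. The
  index 0 has quotient and remainder 0 at every level, so no sign ever appears.\<close>

lemma hadamard_power_row_0:
  "j < 2 ^ m \<Longrightarrow> kron_power hadamard m $$ (0, j) = complex_of_real (1 / sqrt (2 ^ m))"
proof (induction m arbitrary: j)
  case (Suc m)
  have "j div 2 ^ m < 2" using Suc.prems by (simp add: less_mult_imp_div_less)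
  then show ?case
    using Suc by (simp add: index_kron[OF hadamard_carrier hadamard_power_carrier])
      (simp add: hadamard_def real_sqrt_mult)
qed simp

text \<open>Column 0 describes the uniform superposition prepared by the first Hadamard
  layer.\<close>

lemma hadamard_power_col_0:
  "i < 2 ^ m \<Longrightarrow> kron_power hadamard m $$ (i, 0) = complex_of_real (1 / sqrt (2 ^ m))"
proof (induction m arbitrary: i)
  case (Suc m)
  have "i div 2 ^ m < 2" using Suc.prems by (simp add: less_mult_imp_div_less)
  then show ?case
    using Suc by (simp add: index_kron[OF hadamard_carrier hadamard_power_carrier])
      (simp add: hadamard_def real_sqrt_mult)
qed simp

section \<open>Measurements\<close>

lemma ket_projector_carrier: "ket_projector x \<in> carrier_mat (2 ^ length x) (2 ^ length x)"
  by (simp add: ket_projector_def)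

lemma index_ket_projector:
  "i < 2 ^ length x \<Longrightarrow> j < 2 ^ length x \<Longrightarrow>
   ket_projector x $$ (i, j) = of_bool (i = bits_index x \<and> j = bits_index x)"
  by (simp add: ket_projector_def ket_def bits_index_less)

lemma last_qubit_projection:
  "(1\<^sub>m N \<otimes>\<^sub>K ket_projector [b]) *\<^sub>v amp_vec N a = amp_vec N (\<lambda>i c. of_bool (c = b) * a i c)"
proof -
  have "ket_projector [b] \<in> carrier_mat 2 2"
    using ket_projector_carrier[of "[b]"] by simp
  from one_kron_amp_vec[OF this] show ?thesis
    apply simp
    apply (intro amp_vec_cong)
    subgoal for i c
      by (cases b; cases c) (simp_all add: index_ket_projector bits_index_singleton)
    done
qed

lemma first_qubits_projection:
  assumes "length x = m"
  shows "(ket_projector x \<otimes>\<^sub>K 1\<^sub>m 2) *\<^sub>v amp_vec (2 ^ m) a =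
    amp_vec (2 ^ m) (\<lambda>i c. of_bool (i = bits_index x) * a i c)"
proof -
  have "ket_projector x \<in> carrier_mat (2 ^ m) (2 ^ m)"
    using ket_projector_carrier[of x] assms by simp
  from kron_one_amp_vec[OF this] show ?thesis
  proof (simp, intro amp_vec_cong)
    fix i c assume "i < (2 :: nat) ^ m"
    then have "(\<Sum>j<2 ^ m. ket_projector x $$ (i, j) * a j c) =
      (\<Sum>j<2 ^ m. if i = j then of_bool (i = bits_index x) * a j c else 0)"
      using assms by (intro sum.cong) (auto simp: index_ket_projector)
    then show "(\<Sum>j<2 ^ m. ket_projector x $$ (i, j) * a j c) = of_bool (i = bits_index x) * a i c"
      using \<open>i < 2 ^ m\<close> by simp
  qed
qed

text \<open>When the Born weights sum to 1, \<open>embed_pmf\<close> is a genuine distribution,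
  supported exactly on the results of nonzero weight. The rest of the argument uses measurements
  only through this support.\<close>

lemma projective_measurement_outcome:
  assumes "(r, \<phi>) \<in> set_pmf (projective_measurement R P \<psi>)"
    and "finite R" "(\<Sum>r\<in>R. (vec_l2_norm (P r *\<^sub>v \<psi>))\<^sup>2) = 1"
  shows "r \<in> R" "vec_l2_norm (P r *\<^sub>v \<psi>) \<noteq> 0"
    "\<phi> = complex_of_real (1 / vec_l2_norm (P r *\<^sub>v \<psi>)) \<cdot>\<^sub>v (P r *\<^sub>v \<psi>)"
proof -
  let ?p = "\<lambda>r. if r \<in> R then (vec_l2_norm (P r *\<^sub>v \<psi>))\<^sup>2 else 0"
  have "(\<integral>\<^sup>+ r. ennreal (?p r) \<partial>count_space UNIV) = (\<Sum>r\<in>R. ennreal (?p r))"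
    using assms(2) by (intro nn_integral_count_space') auto
  also have "\<dots> = ennreal (\<Sum>r\<in>R. (vec_l2_norm (P r *\<^sub>v \<psi>))\<^sup>2)"
    by (subst sum_ennreal[symmetric]) auto
  finally have "set_pmf (embed_pmf ?p) = {r. ?p r \<noteq> 0}"
    using assms(3) by (intro set_embed_pmf) auto
  with assms(1) show "r \<in> R" "vec_l2_norm (P r *\<^sub>v \<psi>) \<noteq> 0"
    "\<phi> = complex_of_real (1 / vec_l2_norm (P r *\<^sub>v \<psi>)) \<cdot>\<^sub>v (P r *\<^sub>v \<psi>)"
    by (auto simp: projective_measurement_def split: if_splits)
qed

text \<open>Completeness of the two projectors: each coordinate survives exactly one of them. For a
  unit vector this gives the total weight 1 that \<open>projective_measurement_outcome\<close> asks
  for.\<close>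

lemma sum_last_qubit_projections:
  "(\<Sum>b\<in>UNIV. (vec_l2_norm ((1\<^sub>m N \<otimes>\<^sub>K ket_projector [b]) *\<^sub>v amp_vec N a))\<^sup>2) =
   (vec_l2_norm (amp_vec N a))\<^sup>2"
  by (simp add: last_qubit_projection vec_l2_norm_amp_vec UNIV_bool sum.distrib)

lemma norm_first_qubits_projection:
  assumes "length x = m"
  shows "(vec_l2_norm ((ket_projector x \<otimes>\<^sub>K 1\<^sub>m 2) *\<^sub>v amp_vec (2 ^ m) a))\<^sup>2 =
    (cmod (a (bits_index x) False))\<^sup>2 + (cmod (a (bits_index x) True))\<^sup>2"
proof -
  have "(vec_l2_norm ((ket_projector x \<otimes>\<^sub>K 1\<^sub>m 2) *\<^sub>v amp_vec (2 ^ m) a))\<^sup>2 =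
    (\<Sum>i<2 ^ m. if bits_index x = i then (cmod (a i False))\<^sup>2 + (cmod (a i True))\<^sup>2 else 0)"
    unfolding first_qubits_projection[OF assms] vec_l2_norm_amp_vec
    by (intro sum.cong) (auto simp: norm_mult)
  then show ?thesis using bits_index_less[of x] assms by simp
qed

text \<open>Completeness for the first register: the bijection between strings and indices assigns
  each pair of coordinates to one result.\<close>

lemma sum_first_qubits_projections:
  "(\<Sum>x\<in>bit_strings m. (vec_l2_norm ((ket_projector x \<otimes>\<^sub>K 1\<^sub>m 2) *\<^sub>v amp_vec (2 ^ m) a))\<^sup>2) =
   (vec_l2_norm (amp_vec (2 ^ m) a))\<^sup>2"
proof -
  have "(\<Sum>x\<in>bit_strings m. (vec_l2_norm ((ket_projector x \<otimes>\<^sub>K 1\<^sub>m 2) *\<^sub>v amp_vec (2 ^ m) a))\<^sup>2) =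
    (\<Sum>x\<in>bit_strings m. (cmod (a (bits_index x) False))\<^sup>2 + (cmod (a (bits_index x) True))\<^sup>2)"
    by (intro sum.cong) (auto simp: norm_first_qubits_projection bit_strings_def)
  also have "\<dots> = (vec_l2_norm (amp_vec (2 ^ m) a))\<^sup>2"
    unfolding vec_l2_norm_amp_vec sum_bit_strings_index
    by (intro sum.cong) (auto simp: bits_index_index_bits)
  finally show ?thesis .
qed

section \<open>Exactness\<close>

text \<open>The gate Z acts while the last qubit holds the value \<open>f(u0)\<close>, and so turns
  this value into a sign; the second query then adds \<open>f(u1)\<close> to the bit.\<close>

lemma state_before_measurement_amp_vec:
  "state_before_measurement (Suc m) f = amp_vec (2 ^ m) (\<lambda>i c.
     of_bool (c = (f (index_bits m i @ [False]) \<noteq> f (index_bits m i @ [True]))) *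
     ((- 1) ^ of_bool (f (index_bits m i @ [False])) * complex_of_real (1 / sqrt (2 ^ m))))"
proof -
  have Z: "pauli_Z \<in> carrier_mat 2 2" by (simp add: pauli_Z_def)
  have H: "(kron_power hadamard m \<otimes>\<^sub>K 1\<^sub>m 2) *\<^sub>v ket (replicate m False @ [False]) =
    amp_vec (2 ^ m) (\<lambda>i c. of_bool (\<not> c) * complex_of_real (1 / sqrt (2 ^ m)))"
    unfolding ket_amp_vec[OF length_replicate] kron_one_amp_vec[OF hadamard_power_carrier]
  proof (intro amp_vec_cong)
    fix i c assume "i < (2 :: nat) ^ m"
    have "(\<Sum>j<2 ^ m. kron_power hadamard m $$ (i, j) *
        of_bool (j = bits_index (replicate m False) \<and> c = False)) =
      (\<Sum>j<2 ^ m. if j = (0 :: nat) then kron_power hadamard m $$ (i, 0) * of_bool (\<not> c) else 0)"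
      by (intro sum.cong) (auto simp: bits_index_zeros)
    then show "(\<Sum>j<2 ^ m. kron_power hadamard m $$ (i, j) *
        of_bool (j = bits_index (replicate m False) \<and> c = False)) =
      of_bool (\<not> c) * complex_of_real (1 / sqrt (2 ^ m))"
      using hadamard_power_col_0[OF \<open>i < 2 ^ m\<close>] by simp
  qed
  show ?thesis
    unfolding state_before_measurement_def diff_Suc_1 H query_gate_amp_vec one_kron_amp_vec[OF Z]
    by (intro amp_vec_cong) (auto simp: pauli_Z_def restrict_last_def)
qed

text \<open>For each of the \<open>2 ^ m\<close> indices exactly one value of the last bit has a
  nonzero amplitude, of squared modulus \<open>1 / 2 ^ m\<close>.\<close>

lemma norm_state_before_measurement: "(vec_l2_norm (state_before_measurement (Suc m) f))\<^sup>2 = 1"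
proof -
  have "(vec_l2_norm (state_before_measurement (Suc m) f))\<^sup>2 = (\<Sum>i<2 ^ m :: nat. 1 / 2 ^ m)"
    unfolding state_before_measurement_amp_vec vec_l2_norm_amp_vec
    by (intro sum.cong) (auto simp: norm_mult norm_power norm_divide power_divide)
  then show ?thesis by simp
qed

section \<open>Sums of signs for balanced and constant functions\<close>

lemma balanced_fun_sum_signs:
  assumes "n \<ge> 1" "balanced_fun n f"
  shows "(\<Sum>x\<in>bit_strings n. (- 1) ^ of_bool (f x)) = (0 :: complex)"
proof -
  \<comment> \<open>A sign is the indicator of value 0 minus the indicator of value 1, so the sum is
    a difference of two cardinalities.\<close>
  have "(\<Sum>x\<in>bit_strings n. (- 1) ^ of_bool (f x)) =
    (\<Sum>x\<in>bit_strings n. of_bool (\<not> f x) - of_bool (f x) :: complex)"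
    by (intro sum.cong) auto
  also have "\<dots> = of_nat (card (bit_strings n \<inter> {x. \<not> f x})) - of_nat (card (bit_strings n \<inter> {x. f x}))"
    by (simp add: sum_subtractf finite_bit_strings)
  also have "\<dots> = 0"
    using assms(2) by (simp add: balanced_fun_def Int_def)
  finally show ?thesis .
qed

text \<open>Reduces exactness to a statement about possible outputs, so no output probability has to
  be computed.\<close>

lemma pmf_eq_1I: "set_pmf p \<subseteq> {x} \<Longrightarrow> pmf p x = 1"
  by (simp add: set_pmf_subset_singleton)

text \<open>Up to a positive factor, the amplitude of the all-zero basis state after result 0 and
  the second Hadamard layer; see \<open>last_qubit_False_amplitudes\<close>.\<close>

definition agreement_sum :: "nat \<Rightarrow> (bool list \<Rightarrow> bool) \<Rightarrow> complex" where
  "agreement_sum m f = (\<Sum>u\<in>bit_strings m.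
     of_bool (f (u @ [False]) = f (u @ [True])) * (- 1) ^ of_bool (f (u @ [False])))"

lemma agreement_sum_balanced:
  assumes "balanced_fun (Suc m) f"
  shows "agreement_sum m f = 0"
proof -
  have "0 = (\<Sum>x\<in>bit_strings (Suc m). (- 1) ^ of_bool (f x) :: complex)"
    using balanced_fun_sum_signs[of "Suc m" f] assms by simp
  \<comment> \<open>Two equal values contribute their common sign twice; two different values
    contribute 0.\<close>
  also have "\<dots> = 2 * agreement_sum m f"
    unfolding sum_bit_strings_Suc agreement_sum_def sum_distrib_left
    by (intro sum.cong) auto
  finally show ?thesis by simp
qed

lemma cmod_agreement_sum_constant:
  assumes "constant_fun (Suc m) f"
  shows "cmod (agreement_sum m f) = 2 ^ m"
proof -
  have "u @ [b] \<in> bit_strings (Suc m)" if "u \<in> bit_strings m" for u b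
    using that by (simp add: bit_strings_def)
  with assms obtain v where "\<And>u b. u \<in> bit_strings m \<Longrightarrow> f (u @ [b]) = v"
    unfolding constant_fun_def by blast
  then have "agreement_sum m f = (\<Sum>u\<in>bit_strings m. (- 1) ^ of_bool v)"
    unfolding agreement_sum_def by (intro sum.cong) auto
  then show ?thesis by (simp add: card_bit_strings norm_mult norm_power)
qed

text \<open>The factor \<open>r\<close> is the renormalization \<open>1 / p\<close>, where
  \<open>p\<close> is the norm of the projected state. Its exact value is dropped: a zero amplitude
  stays zero for any \<open>r\<close>, and \<open>r \<ge> 1\<close> is enough for the constant
  case.\<close>

lemma last_qubit_False_amplitudes:
  assumes "(False, \<phi>) \<in> set_pmf (measure_last_qubit m (state_before_measurement (Suc m) f))"
  obtains r a where
    "(kron_power hadamard m \<otimes>\<^sub>K 1\<^sub>m 2) *\<^sub>v \<phi> = amp_vec (2 ^ m) a"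
    "vec_l2_norm (amp_vec (2 ^ m) a) = 1"
    "\<And>i. a i True = 0"
    "a 0 False = complex_of_real r * agreement_sum m f / 2 ^ m" "r \<ge> 1"
proof -
  \<comment> \<open>\<open>S\<close>, \<open>v\<close> and \<open>a\<close> are the amplitudes
    before the measurement, after projection and renormalization, and after the second Hadamard
    layer.\<close>
  define S where "S = (\<lambda>i c.
     of_bool (c = (f (index_bits m i @ [False]) \<noteq> f (index_bits m i @ [True]))) *
     ((- 1) ^ of_bool (f (index_bits m i @ [False])) * complex_of_real (1 / sqrt (2 ^ m))))"
  define p where
    "p = vec_l2_norm ((1\<^sub>m (2 ^ m) \<otimes>\<^sub>K ket_projector [False]) *\<^sub>v amp_vec (2 ^ m) S)"
  define v where "v = (\<lambda>i c. complex_of_real (1 / p) * (of_bool (c = False) * S i c))"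
  define a where "a = (\<lambda>i c. \<Sum>j<2 ^ m. kron_power hadamard m $$ (i, j) * v j c)"
  have state: "state_before_measurement (Suc m) f = amp_vec (2 ^ m) S"
    unfolding S_def by (rule state_before_measurement_amp_vec)
  have norm_S: "(vec_l2_norm (amp_vec (2 ^ m) S))\<^sup>2 = 1"
    using norm_state_before_measurement[of m f] by (simp add: state)
  have total: "(\<Sum>b\<in>UNIV.
      (vec_l2_norm ((1\<^sub>m (2 ^ m) \<otimes>\<^sub>K ket_projector [b]) *\<^sub>v amp_vec (2 ^ m) S))\<^sup>2) = 1"
    unfolding sum_last_qubit_projections by (rule norm_S)
  note outcome = projective_measurement_outcome[OF
    assms[unfolded measure_last_qubit_def state] finite total, folded p_def]
  have p: "p \<noteq> 0" by (rule outcome(2))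
  have \<phi>: "\<phi> = complex_of_real (1 / p) \<cdot>\<^sub>v
      ((1\<^sub>m (2 ^ m) \<otimes>\<^sub>K ket_projector [False]) *\<^sub>v amp_vec (2 ^ m) S)"
    by (rule outcome(3))
  have "p \<ge> 0" by (simp add: p_def vec_l2_norm_def)
  with p have "p > 0" by simp
  have \<phi>_v: "\<phi> = amp_vec (2 ^ m) v"
    by (simp add: \<phi> last_qubit_projection smult_amp_vec v_def)
  have "vec_l2_norm \<phi> = 1"
    using \<open>p > 0\<close> unfolding \<phi> vec_l2_norm_smult p_def[symmetric] by (simp add: norm_divide)
  moreover have H: "(kron_power hadamard m \<otimes>\<^sub>K 1\<^sub>m 2) *\<^sub>v \<phi> = amp_vec (2 ^ m) a"
    unfolding \<phi>_v a_def by (rule kron_one_amp_vec[OF hadamard_power_carrier])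
  ultimately have norm_a: "vec_l2_norm (amp_vec (2 ^ m) a) = 1"
    using vec_l2_norm_orthonormal_cols[OF orthonormal_cols_kron_power[OF orthonormal_cols_hadamard]
      hadamard_power_carrier, of m v]
    by (simp add: \<phi>_v)
  \<comment> \<open>The weight of result 0 is one of two nonnegative weights with sum 1.\<close>
  have "p\<^sup>2 \<le> (\<Sum>b\<in>UNIV.
      (vec_l2_norm ((1\<^sub>m (2 ^ m) \<otimes>\<^sub>K ket_projector [b]) *\<^sub>v amp_vec (2 ^ m) S))\<^sup>2)"
    unfolding p_def by (rule member_le_sum) auto
  also note total
  finally have "p \<le> 1" using \<open>p > 0\<close> by (simp add: power_le_one_iff)
  with \<open>p > 0\<close> have "1 / p \<ge> 1" by simp
  \<comment> \<open>The same factor \<open>t\<close> occurs in the prepared state and in row 0 of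
    the Hadamard power; together they give \<open>1 / 2 ^ m\<close>.\<close>
  define t where "t = complex_of_real (1 / sqrt (2 ^ m))"
  have "t * t = complex_of_real (1 / 2 ^ m)"
    unfolding t_def of_real_mult[symmetric] by simp
  then have t: "t * t = 1 / 2 ^ m" by simp
  have "a 0 False = (\<Sum>j<2 ^ m. complex_of_real (1 / p) / 2 ^ m *
      (of_bool (f (index_bits m j @ [False]) = f (index_bits m j @ [True])) *
       (- 1) ^ of_bool (f (index_bits m j @ [False]))))"
    unfolding a_def
  proof (intro sum.cong refl)
    fix j assume "j \<in> {..<(2 :: nat) ^ m}"
    then have "kron_power hadamard m $$ (0, j) = t"
      unfolding t_def by (intro hadamard_power_row_0) simp
    then have "kron_power hadamard m $$ (0, j) * v j False = complex_of_real (1 / p) * (t * t) *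
      (of_bool (f (index_bits m j @ [False]) = f (index_bits m j @ [True])) *
       (- 1) ^ of_bool (f (index_bits m j @ [False])))"
      unfolding v_def S_def t_def[symmetric] by simp
    then show "kron_power hadamard m $$ (0, j) * v j False = complex_of_real (1 / p) / 2 ^ m *
      (of_bool (f (index_bits m j @ [False]) = f (index_bits m j @ [True])) *
       (- 1) ^ of_bool (f (index_bits m j @ [False])))"
      unfolding t by simp
  qed
  also have "\<dots> = complex_of_real (1 / p) * agreement_sum m f / 2 ^ m"
    unfolding agreement_sum_def sum_bit_strings_index sum_distrib_left[symmetric] by simp
  finally have "a 0 False = complex_of_real (1 / p) * agreement_sum m f / 2 ^ m" .
  moreover have "a i True = 0" for i by (simp add: a_def v_def)
  ultimately show ?thesis using that[OF H norm_a] \<open>1 / p \<ge> 1\<close> by blast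
qed

text \<open>Result 1 keeps only prefixes on which the two restrictions differ, and a constant
  \<open>f\<close> has none, so its weight is 0.\<close>

lemma last_qubit_True_impossible:
  assumes "constant_fun (Suc m) f"
  shows "(True, \<phi>) \<notin> set_pmf (measure_last_qubit m (state_before_measurement (Suc m) f))"
proof -
  define S where "S = (\<lambda>i c.
     of_bool (c = (f (index_bits m i @ [False]) \<noteq> f (index_bits m i @ [True]))) *
     ((- 1) ^ of_bool (f (index_bits m i @ [False])) * complex_of_real (1 / sqrt (2 ^ m))))"
  have state: "state_before_measurement (Suc m) f = amp_vec (2 ^ m) S"
    unfolding S_def by (rule state_before_measurement_amp_vec)
  have norm_S: "(vec_l2_norm (amp_vec (2 ^ m) S))\<^sup>2 = 1"
    using norm_state_before_measurement[of m f] by (simp add: state)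
  have "S i True = 0" if "i < 2 ^ m" for i
  proof -
    have "index_bits m i @ [b] \<in> bit_strings (Suc m)" for b
      using index_bits_in[OF that] by (simp add: bit_strings_def)
    with assms have "f (index_bits m i @ [False]) = f (index_bits m i @ [True])"
      unfolding constant_fun_def by blast
    then show ?thesis by (simp add: S_def)
  qed
  then have "(vec_l2_norm ((1\<^sub>m (2 ^ m) \<otimes>\<^sub>K ket_projector [True]) *\<^sub>v amp_vec (2 ^ m) S))\<^sup>2 = 0"
    unfolding last_qubit_projection vec_l2_norm_amp_vec by simp
  then show ?thesis
    unfolding measure_last_qubit_def state
    using projective_measurement_outcome(2)[of True \<phi> UNIV
        "\<lambda>b. 1\<^sub>m (2 ^ m) \<otimes>\<^sub>K ket_projector [b]" "amp_vec (2 ^ m) S"]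
    by (auto simp: sum_last_qubit_projections norm_S)
qed

section \<open>Possible outputs of the procedure\<close>

lemma first_qubits_outcome:
  assumes "vec_l2_norm (amp_vec (2 ^ m) a) = 1"
    and "(x, \<psi>) \<in> set_pmf (measure_first_qubits m (amp_vec (2 ^ m) a))"
  shows "length x = m" "(cmod (a (bits_index x) False))\<^sup>2 + (cmod (a (bits_index x) True))\<^sup>2 \<noteq> 0"
proof -
  have total: "(\<Sum>x\<in>bit_strings m.
      (vec_l2_norm ((ket_projector x \<otimes>\<^sub>K 1\<^sub>m 2) *\<^sub>v amp_vec (2 ^ m) a))\<^sup>2) = 1"
    by (simp add: sum_first_qubits_projections assms(1))
  note outcome = projective_measurement_outcome[OF
    assms(2)[unfolded measure_first_qubits_def] finite_bit_strings total]
  from outcome(1) show len: "length x = m" by (simp add: bit_strings_def)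
  show "(cmod (a (bits_index x) False))\<^sup>2 + (cmod (a (bits_index x) True))\<^sup>2 \<noteq> 0"
    using outcome(2) by (simp flip: norm_first_qubits_projection[OF len])
qed

lemma procedure_output_constant:
  assumes "constant_fun (Suc m) f"
  shows "set_pmf (procedure_output (Suc m) f) \<subseteq> {Constant}"
proof -
  have "x = replicate m False"
    if \<phi>: "(False, \<phi>) \<in> set_pmf (measure_last_qubit m (state_before_measurement (Suc m) f))"
      and x: "(x, \<psi>) \<in> set_pmf (measure_first_qubits m ((kron_power hadamard m \<otimes>\<^sub>K 1\<^sub>m 2) *\<^sub>v \<phi>))"
    for \<phi> x \<psi>
  proof -
    obtain r a where a: "(kron_power hadamard m \<otimes>\<^sub>K 1\<^sub>m 2) *\<^sub>v \<phi> = amp_vec (2 ^ m) a"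
      "vec_l2_norm (amp_vec (2 ^ m) a) = 1"
      "a 0 False = complex_of_real r * agreement_sum m f / 2 ^ m" "r \<ge> 1"
      by (rule last_qubit_False_amplitudes[OF \<phi>]) blast
    \<comment> \<open>\<open>w i\<close> is the Born weight of the string with index
      \<open>i\<close> in the second measurement.\<close>
    define w where "w = (\<lambda>i. (cmod (a i False))\<^sup>2 + (cmod (a i True))\<^sup>2)"
    have "cmod (a 0 False) \<ge> 1"
      using a(4) cmod_agreement_sum_constant[OF assms]
      by (simp add: a(3) norm_mult norm_divide norm_power)
    then have "w 0 \<ge> 1"
      by (simp add: w_def add_increasing2)
    moreover have "sum w {..<2 ^ m} = 1"
      using vec_l2_norm_amp_vec[of "2 ^ m" a] a(2) by (simp add: w_def)
    \<comment> \<open>A second possible string would add a positive weight to \<open>w 0\<close>,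
      which is already at least 1, and exceed the total weight 1.\<close>
    moreover have "x = replicate m False \<or> w 0 + w (bits_index x) \<le> sum w {..<2 ^ m}"
    proof (cases "x = replicate m False")
      case False
      have "length x = m" by (rule first_qubits_outcome(1)[OF a(2) x[unfolded a(1)]])
      with False have "bits_index x \<noteq> 0" "bits_index x < 2 ^ m"
        using bits_index_less[of x] by (simp_all add: bits_index_eq_0_iff)
      then have "sum w {0, bits_index x} \<le> sum w {..<2 ^ m}"
        by (intro sum_mono2) (auto simp: w_def)
      with \<open>bits_index x \<noteq> 0\<close> show ?thesis by simp
    qed simp
    moreover have "w (bits_index x) \<noteq> 0" "w (bits_index x) \<ge> 0"
      using first_qubits_outcome(2)[OF a(2) x[unfolded a(1)]] by (simp_all add: w_def)
    ultimately show ?thesis by linarith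
  qed
  with last_qubit_True_impossible[OF assms] show ?thesis
    by (fastforce simp: procedure_output_def split: if_splits)
qed

lemma procedure_output_balanced:
  assumes "balanced_fun (Suc m) f"
  shows "set_pmf (procedure_output (Suc m) f) \<subseteq> {Balanced}"
proof -
  have "(replicate m False, \<psi>) \<notin>
      set_pmf (measure_first_qubits m ((kron_power hadamard m \<otimes>\<^sub>K 1\<^sub>m 2) *\<^sub>v \<phi>))"
    if \<phi>: "(False, \<phi>) \<in> set_pmf (measure_last_qubit m (state_before_measurement (Suc m) f))"
    for \<phi> \<psi>
  proof
    assume x: "(replicate m False, \<psi>) \<in>
      set_pmf (measure_first_qubits m ((kron_power hadamard m \<otimes>\<^sub>K 1\<^sub>m 2) *\<^sub>v \<phi>))"
    obtain r a where a: "(kron_power hadamard m \<otimes>\<^sub>K 1\<^sub>m 2) *\<^sub>v \<phi> = amp_vec (2 ^ m) a"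
      "vec_l2_norm (amp_vec (2 ^ m) a) = 1" "\<And>i. a i True = 0"
      "a 0 False = complex_of_real r * agreement_sum m f / 2 ^ m"
      by (rule last_qubit_False_amplitudes[OF \<phi>]) blast
    \<comment> \<open>Both amplitudes at index 0 are now 0, whereas a possible result has nonzero
      weight.\<close>
    have "a 0 False = 0" by (simp add: a(4) agreement_sum_balanced[OF assms])
    then show False
      using first_qubits_outcome(2)[OF a(2) x[unfolded a(1)]] by (simp add: a(3) bits_index_zeros)
  qed
  then show ?thesis
    by (auto simp: procedure_output_def split: if_splits)
qed

theorem mainTheorem4:
  fixes n :: nat and f :: "bool list \<Rightarrow> bool"
  assumes "n \<ge> 1"
    and "constant_fun n f \<or> balanced_fun n f"
  shows "(constant_fun n f \<longrightarrow> pmf (procedure_output n f) Constant = 1) \<and>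
         (balanced_fun n f \<longrightarrow> pmf (procedure_output n f) Balanced = 1)"
proof -
  \<comment> \<open>With \<open>n = Suc m\<close> the truncated difference \<open>n - 1\<close> in
    the procedure becomes \<open>m\<close>.\<close>
  obtain m where "n = Suc m" using assms(1) by (cases n) auto
  then show ?thesis
    by (simp add: pmf_eq_1I procedure_output_constant procedure_output_balanced)
qed

end
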